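(* Let $Y$ and $Z$ be topological spaces. The following statements hold. (1) If $Y$ is a regular locally compact space (or a regular locally $Z$-compact space), then the topologies $\tau(t^Z_{co})$, $\tau(t^Z_1)$ and $\tau(t^Z_{1,s})$ on $\mathcal{O}_Z(Y)$ are admissible. (2) If $Y$ is a corecompact space (or a $Z$-corecompact space), then the topologies $\tau(t^Z_1)$ and $\tau(t^Z_{1,s})$ on $\mathcal{O}_Z(Y)$ are admissible. (3) If $Y$ is a locally bounded space (or a locally $Z$-bounded space), then the topology $\tau(t^Z_{1,s})$ on $\mathcal{O}_Z(Y)$ is admissible.
   Context: For a topological space $X$, $\mathcal{O}(X)$ denotes the family of all open subsets of $X$. $C(Y,Z)$ is the set of all continuous maps from $Y$ to $Z$, and $\mathcal{O}_Z(Y)=\{f^{-1}(U): f\in C(Y,Z),\ U\in\mathcal{O}(Z)\}$. $\tau_Y^Z$ is the topology on $Y$ having $\mathcal{O}_Z(Y)$ as a subbasis. A subset $K\subseteq Y$ is $Z$-compact if it is compact in $(Y,\tau_Y^Z)$. $Y$ is locally $Z$-compact if $(Y,\tau_Y^Z)$ is locally compact. The topology $t_{co}^Z$ on $C(Y,Z)$ has as a subbasis all sets $(K,U)=\{f\in C(Y,Z): f(K)\subseteq U\}$ with $K\subseteq Y$ $Z$-compact and $U\in\mathcal{O}(Z)$. $\tau_1^Z$ is the family of all $\mathbb{H}\subseteq\mathcal{O}(Y)$ such that: ($\alpha$) if $A\in\mathbb{H}\cap\mathcal{O}_Z(Y)$, $V\in\mathcal{O}(Y)$ and $A\subseteq V$,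 then $V\in\mathbb{H}$; and ($\beta$) every collection of elements of $\mathcal{O}_Z(Y)$ whose union belongs to $\mathbb{H}$ has a finite subcollection whose union belongs to $\mathbb{H}$. $\tau_{1,s}^Z$ is the family of all $\mathbb{H}\subseteq\mathcal{O}(Y)$ satisfying ($\alpha$) and: ($\beta'$) every collection of elements of $\mathcal{O}_Z(Y)$ whose union equals $Y$ has a finite subcollection whose union belongs to $\mathbb{H}$. The topology $t_1^Z$ (respectively $t_{1,s}^Z$) on $C(Y,Z)$ has as a subbasis all sets $(\mathbb{H},U)=\{f\in C(Y,Z): f^{-1}(U)\in\mathbb{H}\}$ with $\mathbb{H}\in\tau_1^Z$ (respectively $\mathbb{H}\in\tau_{1,s}^Z$) and $U\in\mathcal{O}(Z)$. A subset $K$ of a space $X$ is bounded (in $X$) if every open cover of $X$ has a finite subcollection covering $K$. A space $X$ is corecompact if for every $x\in X$ and every open neighborhood $U$ of $x$ there is an open neighborhood $V\subseteq U$ of $x$ that is bounded in the space $U$. $X$ is locally bounded if for every $x\in X$ and every open neighborhood $U$ of $x$ there is a bounded open neighborhood $V\subseteq U$ of $x$. A subset of $Y$ is $Z$-bounded if it is bounded in $(Y,\tau_Y^Z)$. $Y$ is locally $Z$-bounded if for every $y\in Y$ and every open neighborhood $U$ of $y$ there is a $Z$-bounded neighborhood $g^{-1}(V)\in\mathcal{O}_Z(Y)$ of $y$ with $g^{-1}(V)\subseteq U$. $Y$ is $Z$-corecompact if for every $y\in Y$ and every open neighborhood $U$ of $y$ in $Y$ there is a neighborhood $f^{-1}(V)\in\mathcal{O}_Z(Y)$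 of $y$ with $f^{-1}(V)\subseteq U$ and $f^{-1}(V)$ bounded in $U$, where $U$ carries the topology $\{U\cap W: W\in\tau_Y^Z\}$. Dual topology: for a topology $t$ on $C(Y,Z)$, $\tau(t)$ is the topology on $\mathcal{O}_Z(Y)$ having as a subbasis all sets $(\mathcal{H},U)=\{f^{-1}(U): f\in\mathcal{H}\}$ with $\mathcal{H}\in t$ and $U\in\mathcal{O}(Z)$. Admissibility on $\mathcal{O}_Z(Y)$: for a space $X$ and a map $G:X\to C(Y,Z)$ let $\overline{G}:X\times\mathcal{O}(Z)\to\mathcal{O}_Z(Y)$, $\overline{G}(x,U)=(G(x))^{-1}(U)$, and $\widetilde{G}:X\times Y\to Z$, $\widetilde{G}(x,y)=G(x)(y)$. A map $M:X\times\mathcal{O}(Z)\to(\mathcal{O}_Z(Y),\tau)$ is continuous with respect to the first variable if for each fixed $U\in\mathcal{O}(Z)$ the map $x\mapsto M(x,U)$ from $X$ to $(\mathcal{O}_Z(Y),\tau)$ is continuous. A topology $\tau$ on $\mathcal{O}_Z(Y)$ is admissible if for every space $X$ and every map $G:X\to C(Y,Z)$, continuity with respect to the first variable of $\overline{G}:X\times\mathcal{O}(Z)\to(\mathcal{O}_Z(Y),\tau)$ implies continuity of $\widetilde{G}:X\times Y\to Z$. *)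

theory Defs
  imports "HOL-Analysis.Analysis"
begin

text \<open>The topology on \<open>A\<close> with subbasis \<open>S\<close>. The empty intersection is \<open>A\<close>, so the whole set is
  open even when \<open>S\<close> does not cover \<open>A\<close> (contrast with \<^const>\<open>topology_generated_by\<close>).\<close>

definition subbase_topology :: "'a set \<Rightarrow> 'a set set \<Rightarrow> 'a topology" where
  "subbase_topology A S =
     topology (arbitrary union_of (finite intersection_of (\<lambda>B. B \<in> S) relative_to A))"

text \<open>\<open>C(Y,Z)\<close>. Extensionality makes maps that agree on \<^term>\<open>topspace Y\<close> equal.\<close>

definition cmaps :: "'y topology \<Rightarrow> 'z topology \<Rightarrow> ('y \<Rightarrow> 'z) set" where
  "cmaps Y Z = {f \<in> extensional (topspace Y). continuous_map Y Z f}"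

definition preim :: "'y topology \<Rightarrow> ('y \<Rightarrow> 'z) \<Rightarrow> 'z set \<Rightarrow> 'y set" where
  "preim Y f U = {y \<in> topspace Y. f y \<in> U}"

definition OZ :: "'y topology \<Rightarrow> 'z topology \<Rightarrow> 'y set set" where
  "OZ Y Z = {preim Y f U | f U. f \<in> cmaps Y Z \<and> openin Z U}"

definition tauYZ :: "'y topology \<Rightarrow> 'z topology \<Rightarrow> 'y topology" where
  "tauYZ Y Z = subbase_topology (topspace Y) (OZ Y Z)"

definition Z_compact :: "'y topology \<Rightarrow> 'z topology \<Rightarrow> 'y set \<Rightarrow> bool" where
  "Z_compact Y Z K \<longleftrightarrow> compactin (tauYZ Y Z) K"

text \<open>Local compactness means that every point has a neighbourhood base of compact sets. For regular
  spaces this is the same as having one compact neighbourhood of each point (see the lemma), but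
  \<^term>\<open>tauYZ Y Z\<close> need not be regular, even for regular \<open>Y\<close>.\<close>

definition locally_compact :: "'a topology \<Rightarrow> bool" where
  "locally_compact X \<longleftrightarrow> neighbourhood_base_of (compactin X) X"

lemma regular_locally_compact_iff:
  "regular_space X \<Longrightarrow> locally_compact X \<longleftrightarrow> locally_compact_space X"
  by (simp add: locally_compact_def locally_compact_space_neighbourhood_base)

definition locally_Z_compact :: "'y topology \<Rightarrow> 'z topology \<Rightarrow> bool" where
  "locally_Z_compact Y Z \<longleftrightarrow> locally_compact (tauYZ Y Z)"

definition t_co :: "'y topology \<Rightarrow> 'z topology \<Rightarrow> ('y \<Rightarrow> 'z) topology" where
  "t_co Y Z = subbase_topology (cmaps Y Z)
     {{f \<in> cmaps Y Z. f ` K \<subseteq> U} | K U. K \<subseteq> topspace Y \<and> Z_compact Y Z K \<and> openin Z U}"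

definition cond_alpha :: "'y topology \<Rightarrow> 'z topology \<Rightarrow> 'y set set \<Rightarrow> bool" where
  "cond_alpha Y Z H \<longleftrightarrow> (\<forall>A V. A \<in> H \<inter> OZ Y Z \<and> openin Y V \<and> A \<subseteq> V \<longrightarrow> V \<in> H)"

definition cond_beta :: "'y topology \<Rightarrow> 'z topology \<Rightarrow> 'y set set \<Rightarrow> bool" where
  "cond_beta Y Z H \<longleftrightarrow>
     (\<forall>\<C> \<subseteq> OZ Y Z. \<Union>\<C> \<in> H \<longrightarrow> (\<exists>\<F> \<subseteq> \<C>. finite \<F> \<and> \<Union>\<F> \<in> H))"

definition cond_beta' :: "'y topology \<Rightarrow> 'z topology \<Rightarrow> 'y set set \<Rightarrow> bool" where
  "cond_beta' Y Z H \<longleftrightarrow>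
     (\<forall>\<C> \<subseteq> OZ Y Z. \<Union>\<C> = topspace Y \<longrightarrow> (\<exists>\<F> \<subseteq> \<C>. finite \<F> \<and> \<Union>\<F> \<in> H))"

text \<open>\<open>tau_1\<close> and \<open>tau_1s\<close> are only families of sets of open sets, not topologies.\<close>

definition tau_1 :: "'y topology \<Rightarrow> 'z topology \<Rightarrow> 'y set set set" where
  "tau_1 Y Z = {H. H \<subseteq> {V. openin Y V} \<and> cond_alpha Y Z H \<and> cond_beta Y Z H}"

definition tau_1s :: "'y topology \<Rightarrow> 'z topology \<Rightarrow> 'y set set set" where
  "tau_1s Y Z = {H. H \<subseteq> {V. openin Y V} \<and> cond_alpha Y Z H \<and> cond_beta' Y Z H}"

definition t_1 :: "'y topology \<Rightarrow> 'z topology \<Rightarrow> ('y \<Rightarrow> 'z) topology" where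
  "t_1 Y Z = subbase_topology (cmaps Y Z)
     {{f \<in> cmaps Y Z. preim Y f U \<in> H} | H U. H \<in> tau_1 Y Z \<and> openin Z U}"

definition t_1s :: "'y topology \<Rightarrow> 'z topology \<Rightarrow> ('y \<Rightarrow> 'z) topology" where
  "t_1s Y Z = subbase_topology (cmaps Y Z)
     {{f \<in> cmaps Y Z. preim Y f U \<in> H} | H U. H \<in> tau_1s Y Z \<and> openin Z U}"

definition bounded_in :: "'a topology \<Rightarrow> 'a set \<Rightarrow> bool" where
  "bounded_in X K \<longleftrightarrow> K \<subseteq> topspace X \<and>
     (\<forall>\<C>. (\<forall>C\<in>\<C>. openin X C) \<and> \<Union>\<C> = topspace X \<longrightarrow>
        (\<exists>\<F> \<subseteq> \<C>. finite \<F> \<and> K \<subseteq> \<Union>\<F>))"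

definition corecompact :: "'a topology \<Rightarrow> bool" where
  "corecompact X \<longleftrightarrow>
     (\<forall>x U. openin X U \<and> x \<in> U \<longrightarrow>
        (\<exists>V. openin X V \<and> x \<in> V \<and> V \<subseteq> U \<and> bounded_in (subtopology X U) V))"

definition locally_bounded :: "'a topology \<Rightarrow> bool" where
  "locally_bounded X \<longleftrightarrow>
     (\<forall>x U. openin X U \<and> x \<in> U \<longrightarrow>
        (\<exists>V. openin X V \<and> x \<in> V \<and> V \<subseteq> U \<and> bounded_in X V))"

definition Z_bounded :: "'y topology \<Rightarrow> 'z topology \<Rightarrow> 'y set \<Rightarrow> bool" where
  "Z_bounded Y Z K \<longleftrightarrow> bounded_in (tauYZ Y Z) K"

definition locally_Z_bounded :: "'y topology \<Rightarrow> 'z topology \<Rightarrow> bool" where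
  "locally_Z_bounded Y Z \<longleftrightarrow>
     (\<forall>y U. openin Y U \<and> y \<in> U \<longrightarrow>
        (\<exists>V \<in> OZ Y Z. y \<in> V \<and> V \<subseteq> U \<and> Z_bounded Y Z V))"

text \<open>Here \<open>U\<close> is open in \<open>Y\<close> but carries the trace of the coarser topology \<^term>\<open>tauYZ Y Z\<close>;
  \<open>U\<close> itself need not be open in that topology.\<close>

definition Z_corecompact :: "'y topology \<Rightarrow> 'z topology \<Rightarrow> bool" where
  "Z_corecompact Y Z \<longleftrightarrow>
     (\<forall>y U. openin Y U \<and> y \<in> U \<longrightarrow>
        (\<exists>V \<in> OZ Y Z. y \<in> V \<and> V \<subseteq> U \<and> bounded_in (subtopology (tauYZ Y Z) U) V))"

definition dual_topology ::
    "'y topology \<Rightarrow> 'z topology \<Rightarrow> ('y \<Rightarrow> 'z) topology \<Rightarrow> 'y set topology" where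
  "dual_topology Y Z t = subbase_topology (OZ Y Z)
     {(\<lambda>f. preim Y f U) ` H | H U. openin t H \<and> openin Z U}"

definition continuous_first ::
    "'x topology \<Rightarrow> 'z topology \<Rightarrow> 'a topology \<Rightarrow> ('x \<times> 'z set \<Rightarrow> 'a) \<Rightarrow> bool" where
  "continuous_first X Z \<tau> M \<longleftrightarrow> (\<forall>U. openin Z U \<longrightarrow> continuous_map X \<tau> (\<lambda>x. M (x, U)))"

definition G_bar ::
    "'y topology \<Rightarrow> ('x \<Rightarrow> 'y \<Rightarrow> 'z) \<Rightarrow> 'x \<times> 'z set \<Rightarrow> 'y set" where
  "G_bar Y G = (\<lambda>(x, U). preim Y (G x) U)"

definition G_tilde :: "('x \<Rightarrow> 'y \<Rightarrow> 'z) \<Rightarrow> 'x \<times> 'y \<Rightarrow> 'z" where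
  "G_tilde G = (\<lambda>(x, y). G x y)"

text \<open>HOL cannot quantify over types inside a formula, so the type of the points of the test space
  \<open>X\<close> is a parameter. A theorem that concludes \<open>admissible TYPE('x) Y Z \<tau>\<close> for a type variable
  \<open>'x\<close> not occurring in its hypotheses covers all spaces \<open>X\<close>.\<close>

definition admissible ::
    "'x itself \<Rightarrow> 'y topology \<Rightarrow> 'z topology \<Rightarrow> 'y set topology \<Rightarrow> bool" where
  "admissible _ Y Z \<tau> \<longleftrightarrow> topspace \<tau> = OZ Y Z \<and>
     (\<forall>(X :: 'x topology) G. G ` topspace X \<subseteq> cmaps Y Z \<longrightarrow>
        continuous_first X Z \<tau> (G_bar Y G) \<longrightarrow>
        continuous_map (prod_topology X Y) Z (G_tilde G))"

end

theory Submission
  imports Defs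
begin

text \<open>Fix \<open>f\<close>, an open \<open>W\<close> and \<open>y \<in> f\<^sup>-\<^sup>1(W)\<close>. If an open set of maps \<open>g\<close> that depends only on
  \<open>g\<^sup>-\<^sup>1(W)\<close> contains \<open>f\<close> and forces \<open>V \<subseteq> g\<^sup>-\<^sup>1(W)\<close> for some neighbourhood \<open>V\<close> of \<open>y\<close>, then
  \<open>\<tau>(t)\<close> is admissible. For \<open>t\<^sub>c\<^sub>o\<close> such a set is \<open>(K,W)\<close> with \<open>K\<close> a compact neighbourhood of \<open>y\<close>.
  For \<open>t\<^sub>1\<close> it is \<open>(H,W)\<close>, where \<open>H\<close> consists of the open sets \<open>A\<close> such that \<open>V\<close> is bounded in \<open>A\<close>;
  condition \<open>(\<beta>)\<close> is the usual interpolation property of the relation ``bounded in''. For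
  \<open>t\<^sub>1\<^sub>,\<^sub>s\<close> it suffices that \<open>H\<close> consists of the open sets containing a bounded \<open>V\<close>.\<close>

section \<open>Topologies generated by a subbasis, and the topology \<open>tauYZ Y Z\<close>\<close>

lemma openin_subbase_topology:
  "openin (subbase_topology A S) =
     arbitrary union_of (finite intersection_of (\<lambda>B. B \<in> S) relative_to A)"
  unfolding subbase_topology_def by (simp add: istopology_subbase topology_inverse')

lemma topspace_subbase_topology [simp]: "topspace (subbase_topology A S) = A"
  unfolding subbase_topology_def by (rule topspace_subbase)

lemma openin_subbase_topologyI:
  assumes "B \<in> S" "B \<subseteq> A"
  shows "openin (subbase_topology A S) B"
proof -
  \<comment> \<open>Basic open sets are finite intersections cut down to \<open>A\<close>; since
    \<open>B \<subseteq> A\<close>, cutting \<open>B\<close> down changes nothing.\<close>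
  have "(finite intersection_of (\<lambda>B. B \<in> S) relative_to A) (A \<inter> B)"
    by (intro relative_to_inc finite_intersection_of_inc assms)
  then show ?thesis
    unfolding openin_subbase_topology using assms
    by (simp add: Int_absorb1 union_of_inc arbitrary_union_of_inc)
qed

lemma openin_subbase_topology_coarsest:
  assumes "\<And>B. B \<in> S \<Longrightarrow> openin X B" "openin (subbase_topology (topspace X) S) W"
  shows "openin X W"
  using assms minimal_topology_subbase[of "\<lambda>B. B \<in> S" X "topspace X" W]
  unfolding subbase_topology_def by auto

lemma openin_preim:
  assumes "f \<in> cmaps Y Z" "openin Z U"
  shows "openin Y (preim Y f U)"
  using assms openin_continuous_map_preimage unfolding cmaps_def preim_def by blast

lemma openin_OZ: "A \<in> OZ Y Z \<Longrightarrow> openin Y A"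
  unfolding OZ_def using openin_preim by blast

lemma topspace_tauYZ [simp]: "topspace (tauYZ Y Z) = topspace Y"
  by (simp add: tauYZ_def)

lemma openin_tauYZ_OZ: "A \<in> OZ Y Z \<Longrightarrow> openin (tauYZ Y Z) A"
  unfolding tauYZ_def by (simp add: openin_subbase_topologyI openin_OZ openin_subset)

lemma openin_tauYZ_imp_openin: "openin (tauYZ Y Z) W \<Longrightarrow> openin Y W"
  unfolding tauYZ_def using openin_subbase_topology_coarsest openin_OZ by blast

section \<open>Criteria for admissibility of a dual topology\<close>

text \<open>The dual topology sees a map only through its preimages: continuity of
  \<open>G_bar\<close> tells that the preimage of \<open>W\<close> under \<open>G x'\<close> equals
  that under some \<open>g\<close> in the chosen open set. This is why that set is described by a
  predicate \<open>P\<close> on preimages, which transfers from \<open>g\<close> to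
  \<open>G x'\<close>.\<close>

lemma admissible_dual_topologyI:
  assumes top: "topspace t = cmaps Y Z"
    and nbhd: "\<And>f W y. f \<in> cmaps Y Z \<Longrightarrow> openin Z W \<Longrightarrow> y \<in> preim Y f W \<Longrightarrow>
       \<exists>V P. openin Y V \<and> y \<in> V \<and> openin t {g \<in> cmaps Y Z. P (preim Y g W)} \<and>
         P (preim Y f W) \<and> (\<forall>g \<in> cmaps Y Z. P (preim Y g W) \<longrightarrow> V \<subseteq> preim Y g W)"
  shows "admissible TYPE('x) Y Z (dual_topology Y Z t)"
  unfolding admissible_def
proof (intro conjI allI impI)
  show "topspace (dual_topology Y Z t) = OZ Y Z"
    by (simp add: dual_topology_def)
next
  fix X :: "'x topology" and G
  assume G: "G ` topspace X \<subseteq> cmaps Y Z"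
    and cont: "continuous_first X Z (dual_topology Y Z t) (G_bar Y G)"
  show "continuous_map (prod_topology X Y) Z (G_tilde G)"
    unfolding continuous_map_def
  proof (intro conjI allI impI)
    show "G_tilde G \<in> topspace (prod_topology X Y) \<rightarrow> topspace Z"
      using G by (fastforce simp: G_tilde_def cmaps_def continuous_map_def)
  next
    fix W assume W: "openin Z W"
    let ?S = "{p \<in> topspace (prod_topology X Y). G_tilde G p \<in> W}"
    show "openin (prod_topology X Y) ?S"
      unfolding openin_prod_topology_alt
    proof (intro allI impI)
      fix x y assume "(x, y) \<in> ?S"
      then have x: "x \<in> topspace X" and y: "y \<in> preim Y (G x) W"
        by (auto simp: G_tilde_def preim_def)
      then have "G x \<in> cmaps Y Z" using G by blast
      from nbhd[OF this W y] obtain V P where V: "openin Y V" "y \<in> V"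
        and P: "openin t {g \<in> cmaps Y Z. P (preim Y g W)}" "P (preim Y (G x) W)"
        and sub: "\<And>g. g \<in> cmaps Y Z \<Longrightarrow> P (preim Y g W) \<Longrightarrow> V \<subseteq> preim Y g W"
        by blast
      let ?H = "{g \<in> cmaps Y Z. P (preim Y g W)}"
      \<comment> \<open>The image of \<open>?H\<close> is the subbasic set \<open>(?H, W)\<close> of
        the dual topology, and \<open>?N\<close> is its inverse image under the first-variable map
        of \<open>G_bar\<close> at \<open>W\<close>. The box \<open>?N \<times> V\<close> is the
        required neighbourhood of \<open>(x, y)\<close>.\<close>
      let ?N = "{x \<in> topspace X. preim Y (G x) W \<in> (\<lambda>f. preim Y f W) ` ?H}"
      have "openin (dual_topology Y Z t) ((\<lambda>f. preim Y f W) ` ?H)"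
        unfolding dual_topology_def
      proof (rule openin_subbase_topologyI)
        show "(\<lambda>f. preim Y f W) ` ?H \<in> {(\<lambda>f. preim Y f U) ` H |H U. openin t H \<and> openin Z U}"
          using P(1) W by blast
        show "(\<lambda>f. preim Y f W) ` ?H \<subseteq> OZ Y Z"
          using W by (auto simp: OZ_def)
      qed
      moreover have "continuous_map X (dual_topology Y Z t) (\<lambda>x. preim Y (G x) W)"
        using cont W by (simp add: continuous_first_def G_bar_def)
      ultimately have "openin X ?N"
        using openin_continuous_map_preimage by fastforce
      moreover have "x \<in> ?N"
        using x P(2) \<open>G x \<in> cmaps Y Z\<close> by blast
      moreover have "?N \<times> V \<subseteq> ?S"
      proof clarsimp
        fix x' y' g assume x': "x' \<in> topspace X" and y': "y' \<in> V"
          and eq: "preim Y (G x') W = preim Y g W" and "g \<in> cmaps Y Z" "P (preim Y g W)"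
        then have "y' \<in> preim Y (G x') W" using sub by blast
        then show "y' \<in> topspace Y \<and> G_tilde G (x', y') \<in> W"
          by (simp add: preim_def G_tilde_def)
      qed
      ultimately show "\<exists>U V. openin X U \<and> openin Y V \<and> x \<in> U \<and> y \<in> V \<and> U \<times> V \<subseteq> ?S"
        using V by blast
    qed
  qed
qed

lemma admissible_dual_t_co:
  assumes "\<And>y U. U \<in> OZ Y Z \<Longrightarrow> y \<in> U \<Longrightarrow>
     \<exists>V K. openin Y V \<and> Z_compact Y Z K \<and> y \<in> V \<and> V \<subseteq> K \<and> K \<subseteq> U"
  shows "admissible TYPE('x) Y Z (dual_topology Y Z (t_co Y Z))"
proof (rule admissible_dual_topologyI)
  show "topspace (t_co Y Z) = cmaps Y Z" by (simp add: t_co_def)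
next
  fix f W y assume f: "f \<in> cmaps Y Z" and W: "openin Z W" and y: "y \<in> preim Y f W"
  then have "preim Y f W \<in> OZ Y Z" by (auto simp: OZ_def)
  from assms[OF this y] obtain V K where V: "openin Y V" "y \<in> V" "V \<subseteq> K"
    and K: "Z_compact Y Z K" "K \<subseteq> preim Y f W"
    by blast
  then have KY: "K \<subseteq> topspace Y" by (auto simp: preim_def)
  \<comment> \<open>\<open>preim\<close> is cut down to \<open>topspace Y\<close>; by
    \<open>KY\<close> this loses no point of \<open>K\<close>, so the set is subbasic in
    \<open>t_co Y Z\<close>.\<close>
  then have eq: "{g \<in> cmaps Y Z. K \<subseteq> preim Y g W} = {g \<in> cmaps Y Z. g ` K \<subseteq> W}"
    by (auto simp: preim_def)
  have "openin (t_co Y Z) {g \<in> cmaps Y Z. K \<subseteq> preim Y g W}"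
    unfolding eq t_co_def by (rule openin_subbase_topologyI) (use KY K W in blast)+
  with V K show "\<exists>V P. openin Y V \<and> y \<in> V \<and> openin (t_co Y Z) {g \<in> cmaps Y Z. P (preim Y g W)} \<and>
         P (preim Y f W) \<and> (\<forall>g \<in> cmaps Y Z. P (preim Y g W) \<longrightarrow> V \<subseteq> preim Y g W)"
    by (intro exI[of _ V] exI[of _ "\<lambda>A. K \<subseteq> A"]) auto
qed

text \<open>Membership in \<open>H\<close> is itself a condition on the preimage and serves as
  \<open>P\<close>; that every member of \<open>H\<close> contains \<open>V\<close> is the forcing
  condition.\<close>

lemma admissible_dual_t_1:
  assumes "\<And>y U. U \<in> OZ Y Z \<Longrightarrow> y \<in> U \<Longrightarrow>
     \<exists>V. \<exists>H \<in> tau_1 Y Z. openin Y V \<and> y \<in> V \<and> U \<in> H \<and> (\<forall>A \<in> H. V \<subseteq> A)"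
  shows "admissible TYPE('x) Y Z (dual_topology Y Z (t_1 Y Z))"
proof (rule admissible_dual_topologyI)
  show "topspace (t_1 Y Z) = cmaps Y Z" by (simp add: t_1_def)
next
  fix f W y assume f: "f \<in> cmaps Y Z" and W: "openin Z W" and y: "y \<in> preim Y f W"
  then have "preim Y f W \<in> OZ Y Z" by (auto simp: OZ_def)
  from assms[OF this y] obtain V H where V: "openin Y V" "y \<in> V"
    and H: "H \<in> tau_1 Y Z" "preim Y f W \<in> H" "\<forall>A \<in> H. V \<subseteq> A"
    by blast
  have "openin (t_1 Y Z) {g \<in> cmaps Y Z. preim Y g W \<in> H}"
    unfolding t_1_def by (rule openin_subbase_topologyI) (use H W in blast)+
  with V H show "\<exists>V P. openin Y V \<and> y \<in> V \<and> openin (t_1 Y Z) {g \<in> cmaps Y Z. P (preim Y g W)} \<and>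
         P (preim Y f W) \<and> (\<forall>g \<in> cmaps Y Z. P (preim Y g W) \<longrightarrow> V \<subseteq> preim Y g W)"
    by (intro exI[of _ V] exI[of _ "\<lambda>A. A \<in> H"]) auto
qed

lemma admissible_dual_t_1s:
  assumes "\<And>y U. U \<in> OZ Y Z \<Longrightarrow> y \<in> U \<Longrightarrow>
     \<exists>V. \<exists>H \<in> tau_1s Y Z. openin Y V \<and> y \<in> V \<and> U \<in> H \<and> (\<forall>A \<in> H. V \<subseteq> A)"
  shows "admissible TYPE('x) Y Z (dual_topology Y Z (t_1s Y Z))"
proof (rule admissible_dual_topologyI)
  show "topspace (t_1s Y Z) = cmaps Y Z" by (simp add: t_1s_def)
next
  fix f W y assume f: "f \<in> cmaps Y Z" and W: "openin Z W" and y: "y \<in> preim Y f W"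
  then have "preim Y f W \<in> OZ Y Z" by (auto simp: OZ_def)
  from assms[OF this y] obtain V H where V: "openin Y V" "y \<in> V"
    and H: "H \<in> tau_1s Y Z" "preim Y f W \<in> H" "\<forall>A \<in> H. V \<subseteq> A"
    by blast
  have "openin (t_1s Y Z) {g \<in> cmaps Y Z. preim Y g W \<in> H}"
    unfolding t_1s_def by (rule openin_subbase_topologyI) (use H W in blast)+
  with V H show "\<exists>V P. openin Y V \<and> y \<in> V \<and> openin (t_1s Y Z) {g \<in> cmaps Y Z. P (preim Y g W)} \<and>
         P (preim Y f W) \<and> (\<forall>g \<in> cmaps Y Z. P (preim Y g W) \<longrightarrow> V \<subseteq> preim Y g W)"
    by (intro exI[of _ V] exI[of _ "\<lambda>A. A \<in> H"]) auto
qed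

section \<open>Boundedness relative to a subspace\<close>

text \<open>Covers of the subspace and families of open sets of \<open>X\<close> covering
  \<open>A\<close> correspond by taking traces one way and choosing open extensions the other way.
  \<open>A\<close> may be non-open in \<open>X\<close>, which matters when \<open>A\<close> is open
  in \<open>Y\<close> and \<open>X\<close> is \<open>tauYZ Y Z\<close>.\<close>

lemma bounded_in_subtopology_iff:
  assumes "A \<subseteq> topspace X"
  shows "bounded_in (subtopology X A) K \<longleftrightarrow>
    K \<subseteq> A \<and> (\<forall>\<C>. (\<forall>C\<in>\<C>. openin X C) \<and> A \<subseteq> \<Union>\<C> \<longrightarrow> (\<exists>\<F> \<subseteq> \<C>. finite \<F> \<and> K \<subseteq> \<Union>\<F>))"
    (is "?L \<longleftrightarrow> ?R")
proof
  have A: "topspace (subtopology X A) = A" using assms by auto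
  show ?R if L: ?L
  proof (intro conjI allI impI)
    show "K \<subseteq> A" using L by (simp add: bounded_in_def A)
  next
    fix \<C> assume \<C>: "(\<forall>C\<in>\<C>. openin X C) \<and> A \<subseteq> \<Union>\<C>"
    then have "\<forall>C\<in>(\<inter>) A ` \<C>. openin (subtopology X A) C"
      by (auto intro: openin_subtopology_Int2)
    moreover have "\<Union>((\<inter>) A ` \<C>) = topspace (subtopology X A)"
      unfolding A using \<C> by auto
    ultimately obtain \<F> where "\<F> \<subseteq> (\<inter>) A ` \<C>" "finite \<F>" "K \<subseteq> \<Union>\<F>"
      using L unfolding bounded_in_def by meson
    then obtain \<F>' where F': "\<F>' \<subseteq> \<C>" "finite \<F>'" "\<F> = (\<inter>) A ` \<F>'"
      by (meson finite_subset_image)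
    with \<open>K \<subseteq> \<Union>\<F>\<close> have "K \<subseteq> \<Union>\<F>'" by auto
    with F' show "\<exists>\<F>\<subseteq>\<C>. finite \<F> \<and> K \<subseteq> \<Union>\<F>" by meson
  qed
  show ?L if R: ?R
    unfolding bounded_in_def A
  proof (intro conjI allI impI)
    show "K \<subseteq> A" using R by simp
  next
    fix \<C> assume \<C>: "(\<forall>C\<in>\<C>. openin (subtopology X A) C) \<and> \<Union>\<C> = A"
    then obtain T where T: "\<And>C. C \<in> \<C> \<Longrightarrow> openin X (T C) \<and> C = T C \<inter> A"
      unfolding openin_subtopology by metis
    then have "\<And>C. C \<in> \<C> \<Longrightarrow> C \<subseteq> T C" by blast
    then have "\<forall>C\<in>T ` \<C>. openin X C" "A \<subseteq> \<Union>(T ` \<C>)"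
      using T \<C> by blast+
    then obtain \<F> where "\<F> \<subseteq> T ` \<C>" "finite \<F>" "K \<subseteq> \<Union>\<F>"
      using R by meson
    then obtain \<F>' where F': "\<F>' \<subseteq> \<C>" "finite \<F>'" "\<F> = T ` \<F>'"
      by (meson finite_subset_image)
    have "K \<subseteq> \<Union>\<F>'"
    proof
      fix k assume "k \<in> K"
      then have "k \<in> A" using R by auto
      obtain C where C: "C \<in> \<F>'" "k \<in> T C"
        using \<open>k \<in> K\<close> \<open>K \<subseteq> \<Union>\<F>\<close> F'(3) by auto
      \<comment> \<open>\<open>C\<close> is the trace of \<open>T C\<close> on \<open>A\<close>, and
        \<open>k\<close> lies in \<open>A\<close> because \<open>K \<subseteq> A\<close>.\<close>
      then have "k \<in> C" using T F'(1) \<open>k \<in> A\<close> by blast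
      with C show "k \<in> \<Union>\<F>'" by auto
    qed
    with F' show "\<exists>\<F>\<subseteq>\<C>. finite \<F> \<and> K \<subseteq> \<Union>\<F>" by meson
  qed
qed

text \<open>An open family covering \<open>B\<close> covers \<open>A\<close> as well. This
  monotonicity is behind condition (\<alpha>).\<close>

lemma bounded_in_subtopology_mono:
  assumes "bounded_in (subtopology X A) K" "A \<subseteq> B" "B \<subseteq> topspace X"
  shows "bounded_in (subtopology X B) K"
proof -
  have A: "A \<subseteq> topspace X" using assms(2,3) by (rule subset_trans)
  show ?thesis
    unfolding bounded_in_subtopology_iff[OF assms(3)]
  proof (intro conjI allI impI)
    show "K \<subseteq> B"
      using assms(1,2) unfolding bounded_in_subtopology_iff[OF A] by (meson subset_trans)
  next
    fix \<C> assume "(\<forall>C\<in>\<C>. openin X C) \<and> B \<subseteq> \<Union>\<C>"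
    then have "(\<forall>C\<in>\<C>. openin X C) \<and> A \<subseteq> \<Union>\<C>"
      using assms(2) by (meson subset_trans)
    then show "\<exists>\<F>\<subseteq>\<C>. finite \<F> \<and> K \<subseteq> \<Union>\<F>"
      using assms(1) unfolding bounded_in_subtopology_iff[OF A] by meson
  qed
qed

lemma bounded_in_subtopology_compactin:
  assumes "compactin X K" "V \<subseteq> K" "K \<subseteq> U" "U \<subseteq> topspace X"
  shows "bounded_in (subtopology X U) V"
  unfolding bounded_in_subtopology_iff[OF assms(4)]
proof (intro conjI allI impI)
  show "V \<subseteq> U" using assms(2,3) by (rule subset_trans)
next
  fix \<C> assume "(\<forall>C\<in>\<C>. openin X C) \<and> U \<subseteq> \<Union>\<C>"
  then have "\<And>C. C \<in> \<C> \<Longrightarrow> openin X C" "K \<subseteq> \<Union>\<C>"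
    using assms(3) by auto
  from compactinD[OF assms(1) this] obtain \<F> where "finite \<F>" "\<F> \<subseteq> \<C>" "K \<subseteq> \<Union>\<F>"
    by metis
  moreover from this assms(2) have "V \<subseteq> \<Union>\<F>" by (metis subset_trans)
  ultimately show "\<exists>\<F>\<subseteq>\<C>. finite \<F> \<and> V \<subseteq> \<Union>\<F>" by metis
qed

text \<open>Each of the finitely many \<open>G\<close> is covered by a finite part
  \<open>F G\<close> of the cover; the union of these parts is finite and covers
  \<open>V\<close>.\<close>

lemma bounded_in_cover_subset:
  assumes V: "V \<subseteq> \<Union>\<G>" and fin: "finite \<G>" and A: "A \<subseteq> topspace X"
    and bd: "\<And>G. G \<in> \<G> \<Longrightarrow> bounded_in (subtopology X A) G"
  shows "bounded_in (subtopology X A) V"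
  unfolding bounded_in_subtopology_iff[OF A]
proof (intro conjI allI impI)
  have "G \<subseteq> A" if "G \<in> \<G>" for G
    using bd[OF that] unfolding bounded_in_subtopology_iff[OF A] by (rule conjunct1)
  with V show "V \<subseteq> A" by blast
next
  fix \<C> assume "(\<forall>C\<in>\<C>. openin X C) \<and> A \<subseteq> \<Union>\<C>"
  then have "\<exists>\<F>\<subseteq>\<C>. finite \<F> \<and> G \<subseteq> \<Union>\<F>" if "G \<in> \<G>" for G
    using bd[OF that] unfolding bounded_in_subtopology_iff[OF A] by meson
  then have "\<forall>G\<in>\<G>. \<exists>\<F>. \<F> \<subseteq> \<C> \<and> finite \<F> \<and> G \<subseteq> \<Union>\<F>"
    by simp
  from bchoice[OF this] obtain F where F: "\<And>G. G \<in> \<G> \<Longrightarrow> F G \<subseteq> \<C>"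
      "\<And>G. G \<in> \<G> \<Longrightarrow> finite (F G)" "\<And>G. G \<in> \<G> \<Longrightarrow> G \<subseteq> \<Union>(F G)"
    by auto
  show "\<exists>\<F>\<subseteq>\<C>. finite \<F> \<and> V \<subseteq> \<Union>\<F>"
  proof (intro exI conjI)
    show "\<Union>(F ` \<G>) \<subseteq> \<C>" using F(1) by blast
    show "finite (\<Union>(F ` \<G>))" using F(2) fin by simp
    show "V \<subseteq> \<Union>(\<Union>(F ` \<G>))"
    proof
      fix v assume "v \<in> V"
      then obtain G where "G \<in> \<G>" "v \<in> G" using V by auto
      then show "v \<in> \<Union>(\<Union>(F ` \<G>))" using F(3)[of G] by blast
    qed
  qed
qed

section \<open>Corecompactness and families in \<open>tau_1 Y Z\<close>\<close>

text \<open>The topology \<open>T\<close> is \<open>Y\<close> itself or \<^term>\<open>tauYZ Y Z\<close>.\<close>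

definition OZ_corecompact :: "'y topology \<Rightarrow> 'z topology \<Rightarrow> 'y topology \<Rightarrow> bool" where
  "OZ_corecompact Y Z T \<longleftrightarrow>
     topspace T = topspace Y \<and> (\<forall>W. openin T W \<longrightarrow> openin Y W) \<and>
     (\<forall>y U. U \<in> OZ Y Z \<and> y \<in> U \<longrightarrow>
        (\<exists>V. openin T V \<and> y \<in> V \<and> bounded_in (subtopology T U) V))"

text \<open>Interpolation: if \<open>V\<close> is bounded in a union of members of
  \<open>OZ Y Z\<close>, it is covered by finitely many sets, each bounded in a single member, hence
  it is bounded in the union of those finitely many members.\<close>

lemma bounded_filter_tau_1:
  assumes "OZ_corecompact Y Z T"
  shows "{A. openin Y A \<and> bounded_in (subtopology T A) V} \<in> tau_1 Y Z" (is "?H \<in> _")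
proof -
  have T: "topspace T = topspace Y"
    and base: "\<And>y U. U \<in> OZ Y Z \<Longrightarrow> y \<in> U \<Longrightarrow>
        \<exists>V. openin T V \<and> y \<in> V \<and> bounded_in (subtopology T U) V"
    using assms unfolding OZ_corecompact_def by simp_all
  have "cond_alpha Y Z ?H"
    unfolding cond_alpha_def
  proof (intro allI impI)
    fix A B assume AB: "A \<in> ?H \<inter> OZ Y Z \<and> openin Y B \<and> A \<subseteq> B"
    then have "bounded_in (subtopology T A) V" by simp
    moreover have "A \<subseteq> B" "B \<subseteq> topspace T" using AB T openin_subset by auto
    ultimately have "bounded_in (subtopology T B) V" by (rule bounded_in_subtopology_mono)
    with AB show "B \<in> ?H" by simp
  qed
  moreover have "cond_beta Y Z ?H"
    unfolding cond_beta_def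
  proof (intro allI impI)
    fix \<C> assume \<C>: "\<C> \<subseteq> OZ Y Z" and "\<Union>\<C> \<in> ?H"
    then have bd: "bounded_in (subtopology T (\<Union>\<C>)) V" by simp
    have open_Un: "openin Y (\<Union>\<D>)" if "\<D> \<subseteq> \<C>" for \<D>
      using that \<C> by (intro openin_Union openin_OZ[of _ Y Z]) auto
    then have sub: "\<Union>\<D> \<subseteq> topspace T" if "\<D> \<subseteq> \<C>" for \<D>
      using that openin_subset T by metis
    \<comment> \<open>The bound \<open>V\<close> here is unrelated to the fixed one. By
      \<open>base\<close> these sets cover \<open>\<Union>\<C>\<close>, so boundedness of the fixed
      \<open>V\<close> in \<open>\<Union>\<C>\<close> extracts a finite subcover.\<close>
    let ?\<V> = "{V. openin T V \<and> (\<exists>C\<in>\<C>. bounded_in (subtopology T C) V)}"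
    have "\<forall>V\<in>?\<V>. openin T V" by simp
    moreover have "\<Union>\<C> \<subseteq> \<Union>?\<V>"
    proof
      fix y assume "y \<in> \<Union>\<C>"
      then obtain C where C: "C \<in> \<C>" "y \<in> C" by auto
      with base[of C y] \<C> obtain V where "openin T V" "y \<in> V" "bounded_in (subtopology T C) V"
        by auto
      with C(1) show "y \<in> \<Union>?\<V>" by auto
    qed
    ultimately have "\<exists>\<G>\<subseteq>?\<V>. finite \<G> \<and> V \<subseteq> \<Union>\<G>"
      by (intro bd[unfolded bounded_in_subtopology_iff[OF sub[OF order_refl]],
            THEN conjunct2, rule_format])
         (rule conjI)
    then obtain \<G> where \<G>: "\<G> \<subseteq> ?\<V>" "finite \<G>" "V \<subseteq> \<Union>\<G>"
      by (elim exE conjE)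
    then have "\<forall>G\<in>\<G>. \<exists>C. C \<in> \<C> \<and> bounded_in (subtopology T C) G" by auto
    from bchoice[OF this] obtain c where c: "\<And>G. G \<in> \<G> \<Longrightarrow> c G \<in> \<C>"
        "\<And>G. G \<in> \<G> \<Longrightarrow> bounded_in (subtopology T (c G)) G"
      by auto
    then have cC: "c ` \<G> \<subseteq> \<C>" by auto
    have "bounded_in (subtopology T (\<Union>(c ` \<G>))) G" if "G \<in> \<G>" for G
      using c(2)[OF that] _ sub[OF cC] by (rule bounded_in_subtopology_mono) (use that in auto)
    with \<G>(3,2) sub[OF cC] have "bounded_in (subtopology T (\<Union>(c ` \<G>))) V"
      by (rule bounded_in_cover_subset)
    with open_Un[OF cC] have "\<Union>(c ` \<G>) \<in> ?H" by simp
    with cC \<G>(2) show "\<exists>\<F>\<subseteq>\<C>. finite \<F> \<and> \<Union>\<F> \<in> ?H"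
      by (intro exI[of _ "c ` \<G>"]) simp
  qed
  ultimately show ?thesis by (simp add: tau_1_def Collect_mono)
qed

text \<open>By (\<alpha>), \<open>U\<close> brings \<open>topspace Y\<close> into \<open>H\<close>,
  and then (\<beta>) applied to covers of \<open>Y\<close> is (\<beta>'). Some such \<open>U\<close>
  is required: the empty \<open>H\<close> satisfies (\<beta>) vacuously and fails (\<beta>')
  whenever \<open>OZ Y Z\<close> covers \<open>Y\<close>.\<close>

lemma tau_1_imp_tau_1s:
  assumes "H \<in> tau_1 Y Z" "U \<in> H" "U \<in> OZ Y Z"
  shows "H \<in> tau_1s Y Z"
proof -
  have "topspace Y \<in> H"
    using assms openin_subset[OF openin_OZ[OF assms(3)]] unfolding tau_1_def cond_alpha_def by blast
  with assms(1) show ?thesis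
    unfolding tau_1_def tau_1s_def cond_beta_def cond_beta'_def by auto
qed

lemma OZ_corecompact_nbhd_filter:
  assumes cc: "OZ_corecompact Y Z T" and U: "U \<in> OZ Y Z" "y \<in> U"
  shows "\<exists>V. \<exists>H \<in> tau_1 Y Z. openin Y V \<and> y \<in> V \<and> U \<in> H \<and> (\<forall>A \<in> H. V \<subseteq> A)"
proof -
  obtain V where V: "openin T V" "y \<in> V" "bounded_in (subtopology T U) V"
    using cc U unfolding OZ_corecompact_def by blast
  have "openin Y V" using V cc unfolding OZ_corecompact_def by blast
  show ?thesis
  proof (intro exI bexI conjI)
    show "{A. openin Y A \<and> bounded_in (subtopology T A) V} \<in> tau_1 Y Z"
      using cc by (rule bounded_filter_tau_1)
    show "U \<in> {A. openin Y A \<and> bounded_in (subtopology T A) V}"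
      using V(3) openin_OZ[OF U(1)] by simp
    \<comment> \<open>Being bounded in the subspace \<open>A\<close> includes being contained in
      \<open>A\<close>.\<close>
    show "\<forall>A \<in> {A. openin Y A \<and> bounded_in (subtopology T A) V}. V \<subseteq> A"
      by (auto simp: bounded_in_def)
  qed fact+
qed

lemma OZ_corecompact_admissible:
  assumes "OZ_corecompact Y Z T"
  shows "admissible TYPE('x) Y Z (dual_topology Y Z (t_1 Y Z))"
    and "admissible TYPE('x) Y Z (dual_topology Y Z (t_1s Y Z))"
proof -
  note nbhd = OZ_corecompact_nbhd_filter[OF assms]
  show "admissible TYPE('x) Y Z (dual_topology Y Z (t_1 Y Z))"
    using nbhd by (rule admissible_dual_t_1)
  show "admissible TYPE('x) Y Z (dual_topology Y Z (t_1s Y Z))"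
  proof (rule admissible_dual_t_1s)
    fix y U assume U: "U \<in> OZ Y Z" "y \<in> U"
    from nbhd[OF this] obtain V H where
      "H \<in> tau_1 Y Z" "openin Y V" "y \<in> V" "U \<in> H" "\<forall>A \<in> H. V \<subseteq> A"
      by (elim exE bexE conjE)
    \<comment> \<open>The same \<open>H\<close> works for both topologies, as it contains
      \<open>U\<close>, a member of \<open>OZ Y Z\<close>.\<close>
    moreover from this U have "H \<in> tau_1s Y Z" by (intro tau_1_imp_tau_1s)
    ultimately show "\<exists>V. \<exists>H \<in> tau_1s Y Z. openin Y V \<and> y \<in> V \<and> U \<in> H \<and> (\<forall>A \<in> H. V \<subseteq> A)"
      by (intro exI bexI conjI)
  qed
qed

lemma corecompact_imp_OZ_corecompact: "corecompact Y \<Longrightarrow> OZ_corecompact Y Z Y"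
  unfolding corecompact_def OZ_corecompact_def by (meson openin_OZ)

lemma Z_corecompact_imp_OZ_corecompact: "Z_corecompact Y Z \<Longrightarrow> OZ_corecompact Y Z (tauYZ Y Z)"
  unfolding Z_corecompact_def OZ_corecompact_def
  by (metis openin_OZ openin_tauYZ_OZ openin_tauYZ_imp_openin topspace_tauYZ)

text \<open>An open \<open>V\<close> inside a compact \<open>K \<subseteq> U\<close> is bounded in
  \<open>U\<close>, because a cover of \<open>U\<close> covers \<open>K\<close>.\<close>

lemma locally_compact_imp_OZ_corecompact:
  assumes "locally_compact T" "topspace T = topspace Y" "\<And>W. openin T W \<Longrightarrow> openin Y W"
    and "\<And>U. U \<in> OZ Y Z \<Longrightarrow> openin T U"
  shows "OZ_corecompact Y Z T"
  unfolding OZ_corecompact_def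
proof (intro conjI allI impI)
  fix y U assume U: "U \<in> OZ Y Z \<and> y \<in> U"
  then obtain V K where "openin T V" "compactin T K" "y \<in> V" "V \<subseteq> K" "K \<subseteq> U"
    using assms(1,4) unfolding locally_compact_def neighbourhood_base_of by meson
  then show "\<exists>V. openin T V \<and> y \<in> V \<and> bounded_in (subtopology T U) V"
    using bounded_in_subtopology_compactin openin_subset U assms(4) by meson
qed (use assms in auto)

lemma locally_compact_admissible_t_co:
  assumes "locally_compact T" "\<And>W. openin T W \<Longrightarrow> openin Y W"
    and "\<And>U. U \<in> OZ Y Z \<Longrightarrow> openin T U" "\<And>K. compactin T K \<Longrightarrow> Z_compact Y Z K"
  shows "admissible TYPE('x) Y Z (dual_topology Y Z (t_co Y Z))"
proof (rule admissible_dual_t_co)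
  fix y U assume "U \<in> OZ Y Z" "y \<in> U"
  then show "\<exists>V K. openin Y V \<and> Z_compact Y Z K \<and> y \<in> V \<and> V \<subseteq> K \<and> K \<subseteq> U"
    using assms unfolding locally_compact_def neighbourhood_base_of by meson
qed

text \<open>\<open>tauYZ Y Z\<close> is coarser than \<open>Y\<close>, so it has fewer open covers
  to test.\<close>

lemma compactin_imp_Z_compact: "compactin Y K \<Longrightarrow> Z_compact Y Z K"
  unfolding Z_compact_def compactin_def topspace_tauYZ by (meson openin_tauYZ_imp_openin)

section \<open>Bounded sets and families in \<open>tau_1s Y Z\<close>\<close>

text \<open>Condition (\<beta>') tests covers of the whole of \<open>Y\<close> only, so boundedness
  in the whole space replaces interpolation; (\<alpha>) is transitivity of inclusion.\<close>

lemma supersets_tau_1s: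
  assumes "bounded_in T V" "topspace T = topspace Y" "\<And>U. U \<in> OZ Y Z \<Longrightarrow> openin T U"
  shows "{A. openin Y A \<and> V \<subseteq> A} \<in> tau_1s Y Z" (is "?H \<in> _")
proof -
  have "cond_beta' Y Z ?H"
    unfolding cond_beta'_def
  proof (intro allI impI)
    fix \<C> assume \<C>: "\<C> \<subseteq> OZ Y Z" "\<Union>\<C> = topspace Y"
    then have "\<forall>C\<in>\<C>. openin T C" "\<Union>\<C> = topspace T"
      using assms(2,3) by auto
    then obtain \<F> where \<F>: "\<F> \<subseteq> \<C>" "finite \<F>" "V \<subseteq> \<Union>\<F>"
      using assms(1) unfolding bounded_in_def by meson
    moreover have "openin Y (\<Union>\<F>)"
      using \<F>(1) \<C>(1) by (intro openin_Union openin_OZ[of _ Y Z]) auto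
    ultimately show "\<exists>\<F>\<subseteq>\<C>. finite \<F> \<and> \<Union>\<F> \<in> ?H"
      by (intro exI[of _ \<F>]) simp
  qed
  moreover have "cond_alpha Y Z ?H" unfolding cond_alpha_def by blast
  ultimately show ?thesis by (simp add: tau_1s_def Collect_mono)
qed

lemma admissible_dual_t_1s_bounded:
  assumes "topspace T = topspace Y" "\<And>U. U \<in> OZ Y Z \<Longrightarrow> openin T U"
    and base: "\<And>y U. U \<in> OZ Y Z \<Longrightarrow> y \<in> U \<Longrightarrow>
       \<exists>V. openin Y V \<and> y \<in> V \<and> V \<subseteq> U \<and> bounded_in T V"
  shows "admissible TYPE('x) Y Z (dual_topology Y Z (t_1s Y Z))"
proof (rule admissible_dual_t_1s)
  fix y U assume U: "U \<in> OZ Y Z" "y \<in> U"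
  with base obtain V where V: "openin Y V" "y \<in> V" "V \<subseteq> U" "bounded_in T V"
    by blast
  show "\<exists>V. \<exists>H \<in> tau_1s Y Z. openin Y V \<and> y \<in> V \<and> U \<in> H \<and> (\<forall>A \<in> H. V \<subseteq> A)"
  proof (intro exI bexI conjI)
    show "{A. openin Y A \<and> V \<subseteq> A} \<in> tau_1s Y Z"
      using V(4) assms(1,2) by (rule supersets_tau_1s)
    show "U \<in> {A. openin Y A \<and> V \<subseteq> A}"
      using V(3) openin_OZ[OF U(1)] by simp
  qed (use V in auto)
qed

theorem theorem3p1:
  fixes Y :: "'y topology" and Z :: "'z topology"
  shows
    "(regular_space Y \<and> locally_compact Y \<or> regular_space Y \<and> locally_Z_compact Y Z \<longrightarrow>
        admissible TYPE('x) Y Z (dual_topology Y Z (t_co Y Z)) \<and>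
        admissible TYPE('x) Y Z (dual_topology Y Z (t_1 Y Z)) \<and>
        admissible TYPE('x) Y Z (dual_topology Y Z (t_1s Y Z))) \<and>
     (corecompact Y \<or> Z_corecompact Y Z \<longrightarrow>
        admissible TYPE('x) Y Z (dual_topology Y Z (t_1 Y Z)) \<and>
        admissible TYPE('x) Y Z (dual_topology Y Z (t_1s Y Z))) \<and>
     (locally_bounded Y \<or> locally_Z_bounded Y Z \<longrightarrow>
        admissible TYPE('x) Y Z (dual_topology Y Z (t_1s Y Z)))"
proof (intro conjI impI; elim disjE conjE)
  assume "locally_compact Y"
  then have "OZ_corecompact Y Z Y"
    by (rule locally_compact_imp_OZ_corecompact) (auto intro: openin_OZ)
  then show "admissible TYPE('x) Y Z (dual_topology Y Z (t_1 Y Z))"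
    and "admissible TYPE('x) Y Z (dual_topology Y Z (t_1s Y Z))"
    by (rule OZ_corecompact_admissible)+
  show "admissible TYPE('x) Y Z (dual_topology Y Z (t_co Y Z))"
    using \<open>locally_compact Y\<close> by (rule locally_compact_admissible_t_co)
      (auto intro: openin_OZ compactin_imp_Z_compact)
next
  assume "locally_Z_compact Y Z"
  then have lc: "locally_compact (tauYZ Y Z)" by (simp add: locally_Z_compact_def)
  \<comment> \<open>Now \<open>tauYZ Y Z\<close> takes the role of \<open>T\<close>: it contains
    \<open>OZ Y Z\<close> as its subbasis and is coarser than \<open>Y\<close>, and its compact sets
    are the Z-compact ones.\<close>
  then have "OZ_corecompact Y Z (tauYZ Y Z)"
    by (rule locally_compact_imp_OZ_corecompact)
      (auto intro: openin_tauYZ_OZ openin_tauYZ_imp_openin)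
  then show "admissible TYPE('x) Y Z (dual_topology Y Z (t_1 Y Z))"
    and "admissible TYPE('x) Y Z (dual_topology Y Z (t_1s Y Z))"
    by (rule OZ_corecompact_admissible)+
  show "admissible TYPE('x) Y Z (dual_topology Y Z (t_co Y Z))"
    using lc by (rule locally_compact_admissible_t_co)
      (auto intro: openin_tauYZ_OZ openin_tauYZ_imp_openin simp: Z_compact_def)
next
  assume "corecompact Y"
  then show "admissible TYPE('x) Y Z (dual_topology Y Z (t_1 Y Z))"
    and "admissible TYPE('x) Y Z (dual_topology Y Z (t_1s Y Z))"
    by (blast intro: OZ_corecompact_admissible corecompact_imp_OZ_corecompact)+
next
  assume "Z_corecompact Y Z"
  then show "admissible TYPE('x) Y Z (dual_topology Y Z (t_1 Y Z))"
    and "admissible TYPE('x) Y Z (dual_topology Y Z (t_1s Y Z))"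
    by (blast intro: OZ_corecompact_admissible Z_corecompact_imp_OZ_corecompact)+
next
  assume "locally_bounded Y"
  then show "admissible TYPE('x) Y Z (dual_topology Y Z (t_1s Y Z))"
    unfolding locally_bounded_def
    by (intro admissible_dual_t_1s_bounded[of Y]) (auto intro: openin_OZ)
next
  assume "locally_Z_bounded Y Z"
  then show "admissible TYPE('x) Y Z (dual_topology Y Z (t_1s Y Z))"
    unfolding locally_Z_bounded_def Z_bounded_def
    \<comment> \<open>The Z-bounded neighbourhood is a member of \<open>OZ Y Z\<close>, hence open
      in \<open>Y\<close>.\<close>
    by (intro admissible_dual_t_1s_bounded[of "tauYZ Y Z"])
      (auto intro: openin_tauYZ_OZ, meson openin_OZ)
qed

end
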